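(* Assume that the linear operator $\mathcal{A}$ satisfies the $\delta$-$\mathrm{RIP}_{2r}$ property for some $\delta \in [0,1)$. Consider arbitrary constants $\epsilon>0$ and $\tau \in (0,2(\sqrt{2}-1))$ such that $$\delta<\sqrt{1-\frac{3+2\sqrt 2}{4}\tau^2}.$$ Then, with probability at least $\mathbb{P}(\|\mathbf A^Tw\| \leq \epsilon)$, every local minimizer $\hat X \in \mathbb R^{n \times r}$ of the problem $\min_{X\in\mathbb R^{n\times r}} f(X)$, $f(X)=\frac12\|\mathcal A(XX^T)-b+w\|^2$, satisfying $$\|\hat X\hat X^T - M^*\|_F \leq \tau \lambda_r(M^* )$$ also satisfies $$\|\hat X\hat X^T-M^*\|_F \leq \frac{\epsilon(1+\delta)\,C(\tau,M^* )}{\sqrt{1-\frac{3+2\sqrt 2}{4}\tau^2}-\delta},$$ where $$C(\tau,M^* )=\sqrt{\frac{2(\lambda_1(M^* )+\tau \lambda_r(M^* ))}{(1-\tau)\lambda_r(M^* )} }.$$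
   Context: Setting: $M^*\in\mathbb R^{n\times n}$ is a symmetric positive semidefinite matrix with $\mathrm{rank}(M^* )=r$ (the ground truth). $\lambda_i(M)$ denotes the $i$-th largest eigenvalue of $M$. $\mathcal A:\mathbb R^{n\times n}\to\mathbb R^m$ is the linear operator $\mathcal A(M)=[\langle A_1,M\rangle,\dots,\langle A_m,M\rangle]^T$ with given sensing matrices $A_1,\dots,A_m\in\mathbb R^{n\times n}$, where $\langle A,B\rangle=\mathrm{tr}(A^TB)$. $b=\mathcal A(M^* )$, and $w$ is a random noise vector in $\mathbb R^m$ with an arbitrary probability distribution. The matrix $\mathbf A=[\mathrm{vec}(A_1),\dots,\mathrm{vec}(A_m)]^T\in\mathbb R^{m\times n^2}$ represents $\mathcal A$, i.e. $\mathbf A\,\mathrm{vec}(M)=\mathcal A(M)$, where $\mathrm{vec}$ stacks the columns of a matrix. $\|\cdot\|$ is the Euclidean norm of a vector and $\|\cdot\|_F$ the Frobenius norm. RIP: for $\delta\in[0,1)$, $\mathcal A$ satisfies the $\delta$-$\mathrm{RIP}_{2r}$ property if $(1-\delta)\|M\|_F^2\le\|\mathcal A(M)\|^2\le(1+\delta)\|M\|_F^2$ for all $M\in\mathbb R^{n\times n}$ with $\mathrm{rank}(M)\le 2r$. *)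

theory Defs
  imports "HOL-Analysis.Analysis" "HOL-Probability.Probability"
    "HOL-Computational_Algebra.Polynomial"
begin

definition psd :: "real^'n^'n \<Rightarrow> bool" where
  "psd M \<longleftrightarrow> transpose M = M \<and> (\<forall>x. 0 \<le> x \<bullet> (M *v x))"

definition charpoly :: "real^'n^'n \<Rightarrow> real poly" where
  "charpoly M = det (mat [:0, 1:] - map_matrix (\<lambda>c. [:c:]) M)"

text \<open>
  The \<open>i\<close>-th largest eigenvalue, counted with multiplicity and starting at \<open>i = 1\<close>. It is only
  meaningful for \<open>1 \<le> i\<close> and \<open>i\<close> at most the number of real eigenvalues; for a symmetric matrix
  these are all \<open>i\<close> in \<open>{1..n}\<close>.
\<close>
definition nth_eigval :: "nat \<Rightarrow> real^'n^'n \<Rightarrow> real" where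
  "nth_eigval i M = rev (sorted_list_of_multiset (proots (charpoly M))) ! (i - 1)"

text \<open>The library norm on the type \<open>real^'n^'k\<close> is the Frobenius norm.\<close>
lemma norm_eq_frobenius: "norm (M :: real^'n^'k) = sqrt (trace (transpose M ** M))"
proof -
  have "M \<bullet> M = trace (transpose M ** M)"
    unfolding inner_vec_def trace_def matrix_matrix_mult_def transpose_def
    by simp (rule sum.swap)
  then show ?thesis
    by (simp add: norm_eq_sqrt_inner)
qed

definition sensing :: "('m \<Rightarrow> real^'n^'n) \<Rightarrow> real^'n^'n \<Rightarrow> real^'m" where
  "sensing A M = (\<chi> k. trace (transpose (A k) ** M))"

text \<open>
  Vectorization indexes \<open>\<real>\<^bsup>n\<^sup>2\<^esup>\<close> by pairs (column, row), so that the lexicographic order of the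
  index pairs corresponds to stacking the columns.
\<close>
definition vectorize :: "real^'n^'n \<Rightarrow> real^('n \<times> 'n)" where
  "vectorize M = (\<chi> p. M $ snd p $ fst p)"

definition sensing_matrix :: "('m \<Rightarrow> real^'n^'n) \<Rightarrow> real^('n \<times> 'n)^'m" where
  "sensing_matrix A = (\<chi> k. vectorize (A k))"

lemma sensing_matrix_mult_vectorize: "sensing_matrix A *v vectorize M = sensing A M"
  unfolding sensing_matrix_def vectorize_def sensing_def matrix_vector_mult_def trace_def
    matrix_matrix_mult_def transpose_def vec_eq_iff
  by (simp add: sum.cartesian_product case_prod_beta flip: UNIV_Times_UNIV)

definition rip :: "('m::finite \<Rightarrow> real^'n^'n) \<Rightarrow> nat \<Rightarrow> real \<Rightarrow> bool" where
  "rip A k \<delta> \<longleftrightarrow> (\<forall>M. rank M \<le> k \<longrightarrow>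
     (1 - \<delta>) * (norm M)\<^sup>2 \<le> (norm (sensing A M))\<^sup>2 \<and>
     (norm (sensing A M))\<^sup>2 \<le> (1 + \<delta>) * (norm M)\<^sup>2)"

definition recovery_objective ::
    "('m::finite \<Rightarrow> real^'n^'n) \<Rightarrow> real^'m \<Rightarrow> real^'m \<Rightarrow> real^'r^'n \<Rightarrow> real" where
  "recovery_objective A b w X = 1 / 2 * (norm (sensing A (X ** transpose X) - b + w))\<^sup>2"

definition local_minimizer :: "('a::topological_space \<Rightarrow> real) \<Rightarrow> 'a \<Rightarrow> bool" where
  "local_minimizer f x \<longleftrightarrow> (\<forall>\<^sub>F y in nhds x. f x \<le> f y)"

definition error_const :: "real \<Rightarrow> nat \<Rightarrow> real^'n^'n \<Rightarrow> real" where
  "error_const \<tau> r M = sqrt (2 * (nth_eigval 1 M + \<tau> * nth_eigval r M) /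
     ((1 - \<tau>) * nth_eigval r M))"

end

theory Submission
  imports Defs
begin

text \<open>
  Put \<open>D = X X\<^sup>T - M\<close>, let \<open>P\<close> be the orthogonal projector onto the column space of \<open>X\<close>, and let
  \<open>Q = I - P\<close>. The Frobenius-orthogonal splitting \<open>D = T + Q D Q\<close> has a tangential part of the form
  \<open>T = X U\<^sup>T + U X\<^sup>T\<close>, a direction along which the factored objective can be varied to first order.
  At a local minimizer this gives \<open>\<langle>\<A> T, \<A> D + w\<rangle> = 0\<close>.

  The span of \<open>T\<close> and \<open>D\<close> consists of matrices of rank at most \<open>2 r\<close>, so restricted isometry
  and polarization give \<open>\<langle>\<A> T, \<A> D\<rangle> \<ge> \<langle>T, D\<rangle> - \<delta> \<parallel>T\<parallel> \<parallel>D\<parallel>\<close>, where \<open>\<langle>T, D\<rangle> = \<parallel>T\<parallel>\<^sup>2\<close>. The noise enters only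
  through \<open>\<langle>\<A> T, w\<rangle> = \<langle>vec T, \<^bold>A\<^sup>T w\<rangle>\<close>, which is at most \<open>\<epsilon> \<parallel>T\<parallel>\<close> in absolute value. Hence
  \<open>\<parallel>T\<parallel> \<le> \<delta> \<parallel>D\<parallel> + \<epsilon>\<close>.

  It remains to see that \<open>T\<close> carries most of \<open>D\<close>. Since \<open>Q X = 0\<close>, the normal part is \<open>- Q M Q\<close>, and
  \<open>D Q = - M Q\<close>. The nonzero eigenvalues of \<open>M\<close> are at least \<open>\<lambda>\<^sub>r\<close>, so \<open>M\<^sup>2 \<ge> \<lambda>\<^sub>r M\<close>, and therefore
  \<open>\<parallel>D Q\<parallel>\<^sup>2 \<ge> \<lambda>\<^sub>r tr (Q M Q) \<ge> \<lambda>\<^sub>r \<parallel>Q M Q\<parallel>\<close>. Expanding \<open>\<parallel>P D P\<parallel>\<^sup>2 \<ge> 0\<close> turns this into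
  \<open>2 \<lambda>\<^sub>r \<parallel>Q D Q\<parallel> - \<parallel>Q D Q\<parallel>\<^sup>2 \<le> \<parallel>D\<parallel>\<^sup>2\<close>: the normal part is quadratically small in \<open>D\<close>. For
  \<open>\<parallel>D\<parallel> \<le> \<tau> \<lambda>\<^sub>r\<close> it yields \<open>\<parallel>Q D Q\<parallel> \<le> (1 + \<surd>2) / 2 \<cdot> \<tau> \<parallel>D\<parallel>\<close>, and \<open>(1 + \<surd>2)\<^sup>2 = 3 + 2 \<surd>2\<close>, so that
  \<open>\<parallel>T\<parallel> \<ge> q \<parallel>D\<parallel>\<close> with \<open>q = \<surd>(1 - (3 + 2 \<surd>2) / 4 \<cdot> \<tau>\<^sup>2)\<close>. Together the two estimates for \<open>T\<close> give
  \<open>(q - \<delta>) \<parallel>D\<parallel> \<le> \<epsilon>\<close> (\<open>local_minimizer_error_bound\<close>), which implies the claim because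
  \<open>(1 + \<delta>) C(\<tau>, M) \<ge> 1\<close>.

  Two ingredients surround this argument. The eigenvalues are defined as roots of the
  characteristic polynomial, so a spectral theorem for real symmetric matrices is needed to
  relate them to the quadratic form of \<open>M\<close>. And the probability in question is that of a set of
  noise vectors described by a quantifier over all local minimizers; its complement is a
  countable union of projections of closed sets, hence Borel
  (\<open>borel_local_minimizer_parameters\<close>).
\<close>

section \<open>Eigenvalues of symmetric matrices\<close>

lemma linear_coeff_zero_of_quadratic_nonneg:
  fixes a b :: real
  assumes "\<And>t. 0 \<le> t * a + t\<^sup>2 * b"
  shows "a = 0"
proof (rule ccontr)
  assume "a \<noteq> 0"
  \<comment> \<open>At \<open>t = - a / c\<close> with \<open>c > b\<close> the linear term dominates.\<close>
  define c where "c = \<bar>b\<bar> + 1"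
  have c: "c > 0" "b - c < 0" by (auto simp: c_def)
  have "0 \<le> (- a / c) * a + (- a / c)\<^sup>2 * b" by (rule assms)
  also have "\<dots> = (a / c)\<^sup>2 * (b - c)"
    using c by (simp add: power2_eq_square field_simps)
  also have "\<dots> < 0"
    using c \<open>a \<noteq> 0\<close> by (intro mult_pos_neg) auto
  finally show False by simp
qed

text \<open>
  The eigenvector is a maximizer of the Rayleigh quotient on the unit sphere of \<open>S\<close>. Working in
  an invariant subspace allows the result to be iterated on orthogonal complements.
\<close>

lemma self_adjoint_unit_eigenvector:
  fixes f :: "'a::euclidean_space \<Rightarrow> 'a"
  assumes f: "linear f" and adj: "\<And>x y. f x \<bullet> y = x \<bullet> f y"
    and S: "subspace S" "f ` S \<subseteq> S" "S \<noteq> {0}"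
  obtains v d where "v \<in> S" "norm v = 1" "f v = d *\<^sub>R v"
proof -
  interpret linear f by (rule f)
  have "compact (S \<inter> sphere 0 1)"
    by (intro closed_Int_compact closed_subspace S) auto
  moreover obtain x where x: "x \<in> S" "x \<noteq> 0"
    using S subspace_0 by blast
  then have "x /\<^sub>R norm x \<in> S \<inter> sphere 0 1"
    using S by (auto intro: subspace_scale)
  moreover have "continuous_on (S \<inter> sphere 0 1) (\<lambda>x. x \<bullet> f x)"
    by (intro continuous_intros linear_continuous_on) (use f in \<open>simp add: linear_conv_bounded_linear\<close>)
  ultimately obtain v where v: "v \<in> S \<inter> sphere 0 1"
    and vmax: "\<And>y. y \<in> S \<inter> sphere 0 1 \<Longrightarrow> y \<bullet> f y \<le> v \<bullet> f v"
    by (metis continuous_attains_sup empty_iff)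
  define d where "d = v \<bullet> f v"
  have bound: "y \<bullet> f y \<le> d * (y \<bullet> y)" if "y \<in> S" for y
  proof (cases "y = 0")
    case False
    have "(y /\<^sub>R norm y) \<bullet> f (y /\<^sub>R norm y) \<le> d"
      unfolding d_def using that False S by (intro vmax) (auto intro: subspace_scale)
    then have "(y \<bullet> f y) / (norm y)\<^sup>2 \<le> d"
      by (simp add: scale power2_eq_square field_simps)
    then show ?thesis
      using False by (simp add: field_simps dot_square_norm)
  qed simp
  \<comment> \<open>The quadratic form \<open>d * (y \<bullet> y) - y \<bullet> f y\<close> is nonnegative on \<open>S\<close> and vanishes at \<open>v\<close>,
    so its first variation at \<open>v\<close> vanishes.\<close>
  have "f v \<bullet> u - d * (v \<bullet> u) = 0" if "u \<in> S" for u
  proof -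
    have "2 * (d * (v \<bullet> u) - f v \<bullet> u) = 0"
    proof (rule linear_coeff_zero_of_quadratic_nonneg)
      fix t
      have "v + t *\<^sub>R u \<in> S"
        using v that S by (auto intro: subspace_add subspace_scale)
      from bound[OF this] have
        "0 \<le> d * ((v + t *\<^sub>R u) \<bullet> (v + t *\<^sub>R u)) - (v + t *\<^sub>R u) \<bullet> f (v + t *\<^sub>R u)"
        by simp
      also have "\<dots> = d * (v \<bullet> v) - v \<bullet> f v + t * (2 * (d * (v \<bullet> u) - f v \<bullet> u))
          + t\<^sup>2 * (d * (u \<bullet> u) - u \<bullet> f u)"
        by (simp add: add scale inner_add inner_commute[of u v] adj[of v u, symmetric]
            inner_commute[of u "f v"] algebra_simps power2_eq_square)
      also have "d * (v \<bullet> v) - v \<bullet> f v = 0"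
        using v by (simp add: d_def dot_square_norm)
      finally show "0 \<le> t * (2 * (d * (v \<bullet> u) - f v \<bullet> u)) + t\<^sup>2 * (d * (u \<bullet> u) - u \<bullet> f u)"
        by simp
    qed
    then show ?thesis by simp
  qed
  moreover have "f v - d *\<^sub>R v \<in> S"
    using v S by (auto intro: subspace_diff subspace_scale)
  ultimately have "(f v - d *\<^sub>R v) \<bullet> (f v - d *\<^sub>R v) = 0"
    by (metis inner_diff_left inner_scaleR_left)
  then have "f v = d *\<^sub>R v" by simp
  with v that show thesis by auto
qed

text \<open>
  Induction on the dimension: the part of \<open>S\<close> orthogonal to a unit eigenvector is again
  invariant, by self-adjointness.
\<close>

lemma self_adjoint_orthonormal_eigenbasis:
  fixes f :: "'a::euclidean_space \<Rightarrow> 'a"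
  assumes f: "linear f" and adj: "\<And>x y. f x \<bullet> y = x \<bullet> f y"
    and S: "subspace S" "f ` S \<subseteq> S"
  shows "\<exists>B. B \<subseteq> S \<and> pairwise orthogonal B \<and> (\<forall>b\<in>B. norm b = 1 \<and> (\<exists>d. f b = d *\<^sub>R b)) \<and> span B = S"
  using S
proof (induction "dim S" arbitrary: S rule: less_induct)
  case less
  show ?case
  proof (cases "S = {0}")
    case True
    then show ?thesis by (intro exI[of _ "{}"]) auto
  next
    case False
    then obtain v d where v: "v \<in> S" "norm v = 1" "f v = d *\<^sub>R v"
      using self_adjoint_unit_eigenvector[OF f adj less.prems] by metis
    define S' where "S' = S \<inter> {x. v \<bullet> x = 0}"
    have S': "subspace S'"
      unfolding S'_def by (intro subspace_inter less.prems subspace_hyperplane)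
    have "v \<notin> S'"
      using v by (auto simp: S'_def)
    then have "S' \<subset> S"
      using v unfolding S'_def by blast
    then have "dim S' < dim S"
      using S' less.prems by (intro dim_psubset) (simp add: span_eq_iff[THEN iffD2])
    moreover have "f ` S' \<subseteq> S'"
      using less.prems v by (auto simp: S'_def adj[symmetric])
    ultimately obtain B where B: "B \<subseteq> S'" "pairwise orthogonal B"
      "\<forall>b\<in>B. norm b = 1 \<and> (\<exists>d. f b = d *\<^sub>R b)" "span B = S'"
      using less.hyps S' by metis
    have "S \<subseteq> span (insert v B)"
    proof
      fix x assume "x \<in> S"
      then have "x - (v \<bullet> x) *\<^sub>R v \<in> S'"
        using v less.prems by (auto simp: S'_def inner_diff_right dot_square_norm
            intro: subspace_diff subspace_scale)
      then show "x \<in> span (insert v B)"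
        using B(4) by (auto simp: span_insert)
    qed
    moreover have "span (insert v B) \<subseteq> S"
      using B v less.prems by (intro span_minimal) (auto simp: S'_def)
    moreover have "pairwise orthogonal (insert v B)"
      using B by (auto simp: pairwise_insert S'_def orthogonal_def inner_commute)
    ultimately show ?thesis
      using B v by (intro exI[of _ "insert v B"]) (auto simp: S'_def)
  qed
qed

lemma symmetric_matrix_self_adjoint:
  fixes M :: "real^'n^'n"
  assumes "transpose M = M"
  shows "(M *v x) \<bullet> y = x \<bullet> (M *v y)"
  by (metis assms dot_lmul_matrix transpose_matrix_vector)

text \<open>
  Indexing an orthonormal eigenbasis by the index type of the matrix keeps the multiplicities of
  the eigenvalues \<open>d\<close>.
\<close>

definition orthonormal_eigenfamily :: "real^'n^'n \<Rightarrow> ('n \<Rightarrow> real^'n) \<Rightarrow> ('n \<Rightarrow> real) \<Rightarrow> bool" where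
  "orthonormal_eigenfamily M b d \<longleftrightarrow>
     (\<forall>i j. b i \<bullet> b j = (if i = j then 1 else 0)) \<and> (\<forall>i. M *v b i = d i *\<^sub>R b i)"

lemma symmetric_matrix_eigenfamily:
  fixes M :: "real^'n^'n"
  assumes "transpose M = M"
  obtains b d where "orthonormal_eigenfamily M b d"
proof -
  obtain B where B: "pairwise orthogonal B"
    "\<forall>b\<in>B. norm b = 1 \<and> (\<exists>d. M *v b = d *\<^sub>R b)" "span B = (UNIV :: (real^'n) set)"
    using self_adjoint_orthonormal_eigenbasis[of "(*v) M" UNIV]
      symmetric_matrix_self_adjoint[OF assms] by auto
  have ind: "independent B"
    using B by (intro pairwise_orthogonal_independent) auto
  have "card B = CARD('n)" "finite B"
    using ind B(3) dim_span_eq_card_independent[OF ind] independent_imp_finite[OF ind] by auto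
  then obtain b where b: "bij_betw b (UNIV :: 'n set) B"
    using finite_same_card_bij[of "UNIV :: 'n set" B] by auto
  then have inB: "b i \<in> B" for i using bij_betwE by blast
  have "\<forall>i. \<exists>c. M *v b i = c *\<^sub>R b i"
    using B(2) inB by blast
  then obtain d where "\<And>i. M *v b i = d i *\<^sub>R b i"
    by metis
  moreover have "b i \<bullet> b j = (if i = j then 1 else 0)" for i j
  proof (cases "i = j")
    case True
    then show ?thesis using B(2) inB[of j] by (simp add: dot_square_norm)
  next
    case False
    then have "b i \<noteq> b j" using b by (auto simp: bij_betw_def inj_on_def)
    then show ?thesis
      using False B(1) inB by (auto simp: pairwise_def orthogonal_def)
  qed
  ultimately show thesis
    using that[of b d] unfolding orthonormal_eigenfamily_def by auto
qed

text \<open>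
  The matrix \<open>Q\<close> with rows \<open>b i\<close> is orthogonal, and \<open>Q *v x\<close> lists the coordinates of \<open>x\<close>.
\<close>

lemma parseval_orthonormal_family:
  fixes b :: "'n::finite \<Rightarrow> real^'n"
  assumes b: "\<And>i j. b i \<bullet> b j = (if i = j then 1 else 0)"
  shows "x \<bullet> y = (\<Sum>i\<in>UNIV. (b i \<bullet> x) * (b i \<bullet> y))"
proof -
  define Q where "Q = (\<chi> i k. b i $ k)"
  have Qv: "Q *v z = (\<chi> i. b i \<bullet> z)" for z
    by (simp add: Q_def matrix_vector_mult_def inner_vec_def)
  have "Q ** transpose Q = mat 1"
    using b by (simp add: Q_def matrix_matrix_mult_def transpose_def mat_def inner_vec_def vec_eq_iff)
  then have "orthogonal_matrix Q"
    by (simp add: matrix_left_right_inverse orthogonal_matrix_def)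
  then have "orthogonal_transformation ((*v) Q)"
    by (simp add: orthogonal_transformation_matrix)
  then have "x \<bullet> y = (Q *v x) \<bullet> (Q *v y)"
    by (simp add: orthogonal_transformation_def)
  then show ?thesis
    by (simp add: Qv inner_vec_def)
qed

lemma eigenfamily_image_coord:
  fixes M :: "real^'n^'n"
  assumes "transpose M = M" "orthonormal_eigenfamily M b d"
  shows "b i \<bullet> (M *v x) = d i * (b i \<bullet> x)"
  using assms symmetric_matrix_self_adjoint[of M "b i" x]
  by (simp add: orthonormal_eigenfamily_def)

lemma sum_const_poly: "(\<Sum>k\<in>A. [:f k:]) = [:\<Sum>k\<in>A. f k:]"
  by (induction A rule: infinite_finite_induct) auto

text \<open>
  With the eigenvectors as the columns of \<open>B\<close>, over the polynomial ring \<open>(t I - M) B = B (t I - diag d)\<close>;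
  taking determinants, \<open>det B\<close> cancels because \<open>B\<^sup>T B = I\<close> makes it a unit.
\<close>

lemma charpoly_eigenfamily:
  fixes M :: "real^'n^'n"
  assumes M: "orthonormal_eigenfamily M b d"
  shows "charpoly M = (\<Prod>i\<in>UNIV. [:- d i, 1:])"
proof -
  define K where "K = mat [:0, 1:] - map_matrix (\<lambda>c. [:c:]) M"
  define B where "B = (\<chi> i j. [:b j $ i:])"
  define D where "D = (\<chi> i j. if i = j then [:- d i, 1:] else (0 :: real poly))"
  have "K ** B = B ** D"
  proof -
    have "(K ** B) $ i $ j = (B ** D) $ i $ j" for i j
    proof -
      have "(K ** B) $ i $ j = (\<Sum>k\<in>UNIV. mat [:0, 1:] $ i $ k * [:b j $ k:])
          - (\<Sum>k\<in>UNIV. [:M $ i $ k:] * [:b j $ k:])"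
        by (simp add: K_def B_def matrix_matrix_mult_def smult_diff_right sum_subtractf)
      also have "(\<Sum>k\<in>UNIV. mat [:0, 1:] $ i $ k * [:b j $ k:]) = [:0, b j $ i:]"
        by (simp add: mat_def if_distrib[of "smult _"] cong: if_cong)
      also have "(\<Sum>k\<in>UNIV. [:M $ i $ k:] * [:b j $ k:]) = [:(M *v b j) $ i:]"
        by (simp add: sum_const_poly matrix_vector_mult_def mult.commute)
      also have "(M *v b j) $ i = d j * b j $ i"
        using M by (simp add: orthonormal_eigenfamily_def)
      also have "[:0, b j $ i:] - [:d j * b j $ i:] = [:b j $ i:] * [:- d j, 1:]"
        by simp
      also have "\<dots> = (B ** D) $ i $ j"
        by (simp add: B_def D_def matrix_matrix_mult_def if_distrib[of "smult _"] cong: if_cong)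
      finally show ?thesis .
    qed
    then show ?thesis by (simp add: vec_eq_iff)
  qed
  then have "det K * det B = det B * det D"
    by (metis det_mul)
  moreover have "transpose B ** B = mat 1"
  proof -
    have "(\<Sum>k\<in>UNIV. b i $ k * b j $ k) = (if i = j then 1 else 0)" for i j
      using M by (simp add: orthonormal_eigenfamily_def inner_vec_def)
    then show ?thesis
      by (simp add: B_def transpose_def matrix_matrix_mult_def mat_def vec_eq_iff sum_const_poly
          one_pCons)
  qed
  then have "det (transpose B) * det B = 1"
    by (metis det_mul det_I)
  then have "det B \<noteq> 0" by auto
  ultimately have "det K = det D" by simp
  also have "\<dots> = (\<Prod>i\<in>UNIV. [:- d i, 1:])"
    by (subst det_diagonal) (auto simp: D_def)
  finally show ?thesis
    by (simp add: charpoly_def K_def)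
qed

lemma proots_charpoly_eigenfamily:
  fixes M :: "real^'n^'n"
  assumes "orthonormal_eigenfamily M b d"
  shows "proots (charpoly M) = image_mset d (mset_set UNIV)"
proof -
  have "(\<Sum>i\<in>A. {#d i#}) = image_mset d (mset_set A)" for A
    by (induction A rule: infinite_finite_induct) auto
  then show ?thesis
    by (simp add: charpoly_eigenfamily[OF assms] proots_prod)
qed

text \<open>
  An eigenvector with nonzero eigenvalue lies in the range of the matrix.
\<close>

lemma card_nonzero_eigenvalues_le_rank:
  fixes M :: "real^'n^'n"
  assumes M: "orthonormal_eigenfamily M b d"
  shows "card {i. d i \<noteq> 0} \<le> rank M"
proof -
  have b: "b i \<bullet> b j = (if i = j then 1 else 0)" "M *v b i = d i *\<^sub>R b i" for i j
    using M by (auto simp: orthonormal_eigenfamily_def)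
  have "inj b"
    by (rule injI) (metis b(1) zero_neq_one)
  have "0 \<notin> range b"
    using b(1) by (metis imageE inner_zero_left zero_neq_one)
  then have "independent (b ` {i. d i \<noteq> 0})"
    by (intro pairwise_orthogonal_independent)
      (auto simp: pairwise_def orthogonal_def b(1))
  moreover have "b ` {i. d i \<noteq> 0} \<subseteq> range ((*v) M)"
  proof safe
    fix i assume "d i \<noteq> 0"
    then have "b i = M *v (b i /\<^sub>R d i)"
      by (simp add: matrix_vector_mult_scaleR b(2))
    then show "b i \<in> range ((*v) M)" by blast
  qed
  ultimately have "card (b ` {i. d i \<noteq> 0}) \<le> dim (range ((*v) M))"
    using independent_card_le_dim by blast
  then show ?thesis
    using \<open>inj b\<close> by (simp add: card_image inj_on_subset rank_dim_range)
qed

text \<open>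
  The second part is the spectral gap \<open>M\<^sup>2 \<ge> \<lambda>\<^sub>r M\<close>. In an eigenbasis it says that no eigenvalue lies
  strictly between \<open>0\<close> and \<open>\<lambda>\<^sub>r\<close>: such an eigenvalue, together with the \<open>r\<close> eigenvalues that are at
  least \<open>\<lambda>\<^sub>r\<close>, would give more than \<open>rank M\<close> nonzero ones.
\<close>

lemma nth_eigval_psd:
  fixes M :: "real^'n^'n"
  assumes M: "psd M" and r: "rank M \<le> r" "1 \<le> r" "r \<le> CARD('n)"
  shows nth_eigval_le_largest: "nth_eigval r M \<le> nth_eigval 1 M"
    and nth_eigval_rank_quadratic: "nth_eigval r M * (x \<bullet> (M *v x)) \<le> (M *v x) \<bullet> (M *v x)"
proof -
  have sym: "transpose M = M" using M by (simp add: psd_def)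
  then obtain b d where bd: "orthonormal_eigenfamily M b d"
    using symmetric_matrix_eigenfamily by blast
  define L where "L = rev (sorted_list_of_multiset (proots (charpoly M)))"
  have L: "mset L = image_mset d (mset_set UNIV)" "sorted (rev L)"
    by (simp_all add: L_def proots_charpoly_eigenfamily[OF bd])
  have len: "length L = CARD('n)"
    by (metis L(1) size_mset size_image_mset size_mset_set)
  have nth: "nth_eigval i M = L ! (i - 1)" for i
    by (simp add: nth_eigval_def L_def)
  have mono: "L ! j \<le> L ! i" if "i \<le> j" "j < CARD('n)" for i j
    using that L(2) len by (simp add: sorted_rev_nth_mono)
  show "nth_eigval r M \<le> nth_eigval 1 M"
    unfolding nth using r by (intro mono) auto
  let ?l = "nth_eigval r M"
  have d_nonneg: "0 \<le> d i" for i
    using M bd by (auto simp: psd_def orthonormal_eigenfamily_def dest!: spec[of _ "b i"])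
  have d_gap: "?l * d i \<le> d i * d i" for i
  proof (rule ccontr)
    assume *: "\<not> ?l * d i \<le> d i * d i"
    then have pos: "0 < d i" "d i < ?l"
      using d_nonneg[of i] by (auto simp: not_le less_le mult_le_cancel_right)
    have "r = length (filter (\<lambda>c. ?l \<le> c) (take r L))"
    proof -
      have "\<forall>c\<in>set (take r L). ?l \<le> c"
        using mono r len by (auto simp: nth in_set_conv_nth)
      then show ?thesis using r len by (simp add: filter_id_conv[THEN iffD2])
    qed
    also have "\<dots> \<le> length (filter (\<lambda>c. ?l \<le> c) L)"
      by (metis append_take_drop_id filter_append length_append le_add1)
    also have "\<dots> = size (filter_mset (\<lambda>c. ?l \<le> c) (mset L))"
      by (metis mset_filter size_mset)
    also have "\<dots> = card {j. ?l \<le> d j}"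
      by (simp add: L(1) filter_mset_image_mset)
    also have "\<dots> < card (insert i {j. ?l \<le> d j})"
      using pos by simp
    also have "\<dots> \<le> card {j. d j \<noteq> 0}"
      using pos by (intro card_mono) auto
    also have "\<dots> \<le> rank M"
      by (rule card_nonzero_eigenvalues_le_rank[OF bd])
    finally show False using r by simp
  qed
  have pars: "u \<bullet> v = (\<Sum>i\<in>UNIV. (b i \<bullet> u) * (b i \<bullet> v))" for u v
    using bd by (intro parseval_orthonormal_family) (auto simp: orthonormal_eigenfamily_def)
  have "?l * (x \<bullet> (M *v x)) = (\<Sum>i\<in>UNIV. (?l * d i) * (b i \<bullet> x)\<^sup>2)"
    unfolding pars[of x] eigenfamily_image_coord[OF sym bd]
    by (simp add: sum_distrib_left power2_eq_square mult_ac)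
  also have "\<dots> \<le> (\<Sum>i\<in>UNIV. (d i * d i) * (b i \<bullet> x)\<^sup>2)"
    by (intro sum_mono mult_right_mono d_gap) auto
  also have "\<dots> = (M *v x) \<bullet> (M *v x)"
    unfolding pars[of "M *v x"] eigenfamily_image_coord[OF sym bd]
    by (simp add: power2_eq_square mult_ac)
  finally show "?l * (x \<bullet> (M *v x)) \<le> (M *v x) \<bullet> (M *v x)" .
qed

section \<open>Borel sets defined through local minimizers\<close>

text \<open>
  Projections of Borel sets need not be Borel, but a closed set in a Euclidean space is a
  countable union of compact sets, and these have compact projections.
\<close>

lemma borel_fst_image_closed:
  fixes S :: "('a::euclidean_space \<times> 'b::euclidean_space) set"
  assumes "closed S"
  shows "fst ` S \<in> sets borel"
proof -
  have "fst ` S = (\<Union>j::nat. fst ` (S \<inter> cball 0 (real j)))"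
  proof (intro equalityI subsetI)
    fix x assume "x \<in> fst ` S"
    then obtain z where z: "z \<in> S" "x = fst z" by blast
    obtain j where "norm z \<le> real j" using real_arch_simple by blast
    with z have "z \<in> S \<inter> cball 0 (real j)" by simp
    with z show "x \<in> (\<Union>j::nat. fst ` (S \<inter> cball 0 (real j)))" by blast
  qed auto
  moreover have "closed (fst ` (S \<inter> cball 0 (real j)))" for j
  proof -
    have "compact (S \<inter> cball 0 (real j))"
      using assms by (rule closed_Int_compact) simp
    then show ?thesis
      by (intro compact_imp_closed compact_continuous_image) (intro continuous_intros)
  qed
  ultimately show ?thesis
    by (metis (no_types, lifting) borel_closed sets.countable_UN image_subset_iff)
qed

text \<open>
  Fixing the radius \<open>e\<close> of minimality makes the condition closed jointly in the parameter and the
  point: strictness of \<open>dist y x < e\<close> means that a competitor \<open>y\<close> of a limit point also competes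
  with all nearby points.
\<close>

lemma closed_uniform_local_minimizers:
  fixes f :: "'a::topological_space \<Rightarrow> 'b::metric_space \<Rightarrow> real"
  assumes f: "continuous_on UNIV (\<lambda>z. f (fst z) (snd z))"
  shows "closed {z. \<forall>y. dist y (snd z) < e \<longrightarrow> f (fst z) (snd z) \<le> f (fst z) y}"
proof -
  have "open {z. dist y (snd z) < e \<and> f (fst z) y < f (fst z) (snd z)}" for y
  proof -
    have "continuous_on UNIV (\<lambda>z :: 'a \<times> 'b. f (fst (fst z, y)) (snd (fst z, y)))"
      by (rule continuous_on_compose2[OF f]) (auto intro!: continuous_intros)
    then show ?thesis
      by (intro open_Collect_conj open_Collect_less continuous_intros f) auto
  qed
  then have "open (\<Union>y. {z. dist y (snd z) < e \<and> f (fst z) y < f (fst z) (snd z)})"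
    by blast
  moreover have "- {z. \<forall>y. dist y (snd z) < e \<longrightarrow> f (fst z) (snd z) \<le> f (fst z) y} =
      (\<Union>y. {z. dist y (snd z) < e \<and> f (fst z) y < f (fst z) (snd z)})"
    by (auto simp: not_le)
  ultimately show ?thesis by (simp add: closed_def)
qed

text \<open>
  A violation consists of a local minimizer \<open>x\<close> with \<open>g x \<le> a\<close> and \<open>g x > c\<close>. Both the radius of
  minimality and the excess of \<open>g x\<close> over \<open>c\<close> can be bounded below by \<open>1 / (k + 1)\<close> for some \<open>k\<close>, so
  the parameters that admit a violation are the countable union of the projections of the
  closed sets \<open>S k\<close>.
\<close>

lemma borel_local_minimizer_parameters:
  fixes f :: "'a::euclidean_space \<Rightarrow> 'b::euclidean_space \<Rightarrow> real" and g :: "'b \<Rightarrow> real"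
  assumes f: "continuous_on UNIV (\<lambda>z. f (fst z) (snd z))" and g: "continuous_on UNIV g"
  shows "{w. \<forall>x. local_minimizer (f w) x \<longrightarrow> g x \<le> a \<longrightarrow> g x \<le> c} \<in> sets borel"
proof -
  define S where "S = (\<lambda>k::nat. {z :: 'a \<times> 'b.
      \<forall>y. dist y (snd z) < inverse (real (Suc k)) \<longrightarrow> f (fst z) (snd z) \<le> f (fst z) y}
      \<inter> {z. g (snd z) \<le> a} \<inter> {z. c + inverse (real (Suc k)) \<le> g (snd z)})"
  have g': "continuous_on UNIV (\<lambda>z :: 'a \<times> 'b. g (snd z))"
    by (rule continuous_on_compose2[OF g]) (auto intro!: continuous_intros)
  have "closed (S k)" for k
    unfolding S_def
    by (intro closed_Int closed_uniform_local_minimizers f closed_Collect_le g' continuous_intros)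
  then have "(\<Union>k. fst ` S k) \<in> sets borel"
    by (intro sets.countable_UN) (auto intro: borel_fst_image_closed)
  moreover have "{w. \<forall>x. local_minimizer (f w) x \<longrightarrow> g x \<le> a \<longrightarrow> g x \<le> c} = - (\<Union>k. fst ` S k)"
  proof (rule set_eqI, rule iffI)
    fix w assume w: "w \<in> {w. \<forall>x. local_minimizer (f w) x \<longrightarrow> g x \<le> a \<longrightarrow> g x \<le> c}"
    show "w \<in> - (\<Union>k. fst ` S k)"
    proof
      assume "w \<in> (\<Union>k. fst ` S k)"
      then obtain k x where kx: "(w, x) \<in> S k" by auto
      then have "local_minimizer (f w) x"
        unfolding local_minimizer_def eventually_nhds_metric S_def
        by (auto intro!: exI[of _ "inverse (real (Suc k))"])
      moreover have "g x \<le> a" "c + inverse (real (Suc k)) \<le> g x"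
        using kx by (auto simp: S_def)
      moreover from calculation have "g x \<le> c"
        using w by blast
      moreover have "0 < inverse (real (Suc k))" by simp
      ultimately show False by linarith
    qed
  next
    fix w assume w: "w \<in> - (\<Union>k. fst ` S k)"
    show "w \<in> {w. \<forall>x. local_minimizer (f w) x \<longrightarrow> g x \<le> a \<longrightarrow> g x \<le> c}"
    proof (intro CollectI allI impI, rule ccontr)
      fix x assume x: "local_minimizer (f w) x" "g x \<le> a" "\<not> g x \<le> c"
      then obtain e where e: "e > 0" "\<And>y. dist y x < e \<Longrightarrow> f w x \<le> f w y"
        unfolding local_minimizer_def eventually_nhds_metric by blast
      have "min e (g x - c) > 0" using e x by auto
      then obtain k where "inverse (real (Suc k)) < min e (g x - c)"
        using reals_Archimedean by blast
      with e x have "(w, x) \<in> S k"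
        by (auto simp: S_def simp del: of_nat_Suc)
      with w show False by force
    qed
  qed
  ultimately show ?thesis
    by (metis borel_comp)
qed

section \<open>Matrix algebra and the Frobenius inner product\<close>

lemma matrix_mult_diff_right: "A ** (B - C) = A ** B - A ** (C :: real^'m^'n)"
  by (simp add: matrix_matrix_mult_def vec_eq_iff right_diff_distrib sum_subtractf)

lemma matrix_mult_diff_left: "(A - B) ** C = A ** C - B ** (C :: real^'m^'n)"
  by (simp add: matrix_matrix_mult_def vec_eq_iff left_diff_distrib sum_subtractf)

lemma transpose_add_real: "transpose (A + B) = transpose A + transpose (B :: real^'m^'n)"
  by (simp add: transpose_def vec_eq_iff)

lemma transpose_diff_real: "transpose (A - B) = transpose A - transpose (B :: real^'m^'n)"
  by (simp add: transpose_def vec_eq_iff)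

lemma matrix_mult_add_left: "(A + B) ** C = A ** C + B ** (C :: real^'m^'n)"
  by (simp add: matrix_matrix_mult_def vec_eq_iff distrib_right sum.distrib)

lemma matrix_mult_minus_right: "A ** (- B) = - (A ** (B :: real^'m^'n))"
  by (simp add: matrix_matrix_mult_def vec_eq_iff sum_negf)

lemma matrix_mult_minus_left: "(- A) ** B = - (A ** (B :: real^'m^'n))"
  by (simp add: matrix_matrix_mult_def vec_eq_iff sum_negf)

lemmas matrix_ring_simps = matrix_mult_minus_right matrix_mult_minus_left
  matrix_add_ldistrib matrix_mult_add_left matrix_mult_diff_right
  matrix_mult_diff_left scalar_matrix_assoc[symmetric] matrix_scalar_ac

lemmas transpose_simps = transpose_add_real transpose_diff_real transpose_scalar matrix_transpose_mul

lemma matrix_inner_transpose: "transpose A \<bullet> transpose B = A \<bullet> (B :: real^'m^'n)"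
  unfolding inner_vec_def transpose_def by simp (rule sum.swap)

lemma matrix_inner_mult_right:
  fixes A :: "real^'k^'n" and B :: "real^'m^'k"
  shows "(A ** B) \<bullet> C = A \<bullet> (C ** transpose B)"
proof -
  have "(A ** B) \<bullet> C = (\<Sum>i\<in>UNIV. \<Sum>j\<in>UNIV. \<Sum>k\<in>UNIV. A $ i $ k * B $ k $ j * C $ i $ j)"
    by (simp add: inner_vec_def matrix_matrix_mult_def sum_distrib_right)
  also have "\<dots> = (\<Sum>i\<in>UNIV. \<Sum>k\<in>UNIV. \<Sum>j\<in>UNIV. A $ i $ k * B $ k $ j * C $ i $ j)"
    by (intro sum.cong refl sum.swap)
  also have "\<dots> = A \<bullet> (C ** transpose B)"
    by (simp add: inner_vec_def matrix_matrix_mult_def transpose_def sum_distrib_left mult_ac)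
  finally show ?thesis .
qed

lemma matrix_inner_mult_left:
  fixes A :: "real^'k^'n" and B :: "real^'m^'k"
  shows "(A ** B) \<bullet> C = B \<bullet> (transpose A ** C)"
proof -
  have "(A ** B) \<bullet> C = (transpose B ** transpose A) \<bullet> transpose C"
    by (metis matrix_inner_transpose matrix_transpose_mul)
  also have "\<dots> = transpose B \<bullet> transpose (transpose A ** C)"
    by (simp add: matrix_inner_mult_right matrix_transpose_mul)
  finally show ?thesis by (simp add: matrix_inner_transpose)
qed

lemma rank_add_le: "rank (A + B) \<le> rank A + rank (B :: real^'m^'n)"
proof -
  let ?S = "{x + y |x y. x \<in> range ((*v) A) \<and> y \<in> range ((*v) B)}"
  have "range ((*v) (A + B)) \<subseteq> ?S"
    by (auto simp: matrix_vector_mult_add_rdistrib)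
  then have "dim (range ((*v) (A + B))) \<le> dim ?S"
    by (rule dim_subset)
  also have "\<dots> \<le> dim (range ((*v) A)) + dim (range ((*v) B))"
    using dim_sums_Int[of "range ((*v) A)" "range ((*v) B)"]
    by (simp add: linear_subspace_image)
  finally show ?thesis by (simp add: rank_dim_range)
qed

section \<open>Orthogonal projectors\<close>

definition orth_projector :: "real^'n^'n \<Rightarrow> bool" where
  "orth_projector P \<longleftrightarrow> transpose P = P \<and> P ** P = P"

lemma orth_projector_complement: "orth_projector P \<Longrightarrow> orth_projector (mat 1 - P)"
  by (simp add: orth_projector_def transpose_simps matrix_ring_simps)

text \<open>
  The columns of \<open>K\<close> are least-squares solutions of \<open>X z = e\<^sub>j\<close>. The normal equations
  \<open>X\<^sup>T (I - X K) = 0\<close> make \<open>X K\<close> the orthogonal projector onto the column space of \<open>X\<close>.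
\<close>

lemma column_space_projector:
  fixes X :: "real^'r^'n"
  obtains K where "orth_projector (X ** K)" "(X ** K) ** X = X"
proof -
  have "\<exists>z. transpose X *v (y - X *v z) = 0" for y
  proof -
    obtain u v where uv: "u \<in> span (range ((*v) X))" "y = u + v"
      "\<And>w. w \<in> span (range ((*v) X)) \<Longrightarrow> orthogonal v w"
      using orthogonal_subspace_decomp_exists[of "range ((*v) X)" y] by metis
    have "u \<in> range ((*v) X)"
      using uv(1) by (simp add: span_eq_iff[THEN iffD2] linear_subspace_image)
    then obtain z where z: "u = X *v z" by blast
    have "(transpose X *v v) \<bullet> w = 0" for w
      using uv(3)[of "X *v w"] by (simp add: orthogonal_def dot_lmul_matrix span_base)
    then have "transpose X *v v = 0" by (metis inner_eq_zero_iff)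
    then show ?thesis using z uv(2) by (intro exI[of _ z]) simp
  qed
  then obtain z where z: "\<And>y. transpose X *v (y - X *v z y) = 0" by metis
  define K where "K = (\<chi> k j. z (axis j 1) $ k)"
  define P where "P = X ** K"
  have "transpose X *v (axis j 1 - P *v axis j 1) = 0" for j
  proof -
    have "K *v axis j 1 = z (axis j 1)"
      by (simp add: K_def matrix_vector_mult_basis column_def vec_eq_iff)
    then show ?thesis
      using z[of "axis j 1"] by (simp add: P_def flip: matrix_vector_mul_assoc)
  qed
  then have "column j (transpose X ** (mat 1 - P)) = 0" for j
    by (simp del: transpose_matrix_vector add: matrix_vector_mult_diff_rdistrib
        flip: matrix_vector_mult_basis matrix_vector_mul_assoc)
  then have "transpose X ** (mat 1 - P) = 0"
    by (simp add: column_def vec_eq_iff)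
  then have XP: "transpose X = transpose X ** P"
    by (simp add: matrix_ring_simps)
  have "transpose P ** P = transpose P"
    by (metis P_def XP matrix_mul_assoc matrix_transpose_mul)
  then have sym: "transpose P = P"
    by (metis matrix_transpose_mul transpose_transpose)
  then have "P ** P = P" using \<open>transpose P ** P = transpose P\<close> by simp
  moreover have "P ** X = X"
    by (metis XP matrix_transpose_mul sym transpose_transpose)
  ultimately show thesis
    using that[of K] sym by (simp add: orth_projector_def P_def)
qed

text \<open>
  With \<open>P = I - Q\<close>, the first part is \<open>\<parallel>P D P\<parallel>\<^sup>2 \<ge> 0\<close> written out, using \<open>\<parallel>Q D\<parallel> = \<parallel>D Q\<parallel>\<close>. The other two
  express that \<open>D \<mapsto> Q D Q\<close> is an orthogonal projector on the space of matrices.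
\<close>

lemma symmetric_compression_norm_le:
  fixes D Q :: "real^'n^'n"
  assumes D: "transpose D = D" and Q: "orth_projector Q"
  shows "2 * (norm (D ** Q))\<^sup>2 - (norm (Q ** D ** Q))\<^sup>2 \<le> (norm D)\<^sup>2"
    and "(norm (D - Q ** D ** Q))\<^sup>2 = (norm D)\<^sup>2 - (norm (Q ** D ** Q))\<^sup>2"
    and "(D - Q ** D ** Q) \<bullet> D = (norm (D - Q ** D ** Q))\<^sup>2"
proof -
  have QQ: "transpose Q = Q" "Q ** Q = Q" "Q ** (Q ** Z) = Q ** Z" for Z :: "real^'n^'n"
    using Q by (simp_all add: orth_projector_def matrix_mul_assoc)
  note moves = matrix_inner_mult_right[of _ Q] matrix_inner_mult_left[of Q] QQ
  have swap: "D \<bullet> (Q ** D) = D \<bullet> (D ** Q)"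
    using matrix_inner_transpose[of D "Q ** D"] by (simp add: matrix_transpose_mul D QQ)
  \<comment> \<open>The expanded matrix is \<open>(I - Q) D (I - Q)\<close>.\<close>
  have "0 \<le> (D - D ** Q - Q ** D + Q ** (D ** Q)) \<bullet> (D - D ** Q - Q ** D + Q ** (D ** Q))"
    by simp
  also have "\<dots> = D \<bullet> D - 2 * (D \<bullet> (D ** Q)) + D \<bullet> (Q ** (D ** Q))"
    by (simp add: inner_add inner_diff moves swap flip: matrix_mul_assoc)
  finally show "2 * (norm (D ** Q))\<^sup>2 - (norm (Q ** D ** Q))\<^sup>2 \<le> (norm D)\<^sup>2"
    by (simp add: power2_norm_eq_inner moves flip: matrix_mul_assoc)
  show "(norm (D - Q ** D ** Q))\<^sup>2 = (norm D)\<^sup>2 - (norm (Q ** D ** Q))\<^sup>2"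
    and "(D - Q ** D ** Q) \<bullet> D = (norm (D - Q ** D ** Q))\<^sup>2"
    by (simp_all add: power2_norm_eq_inner inner_diff moves flip: matrix_mul_assoc)
qed

text \<open>
  This is the Cauchy-Schwarz inequality for the semi-inner product of \<open>N\<close>, applied to two unit
  coordinate vectors.
\<close>

lemma psd_entry_sq_le:
  assumes N: "psd N"
  shows "(N $ i $ j)\<^sup>2 \<le> N $ i $ i * N $ j $ j"
proof -
  have sym: "N $ j $ i = N $ i $ j"
  proof -
    have "transpose N $ i $ j = N $ i $ j" using N by (simp add: psd_def)
    then show ?thesis by (simp add: transpose_def)
  qed
  have entry: "axis k 1 \<bullet> (N *v axis l 1) = N $ k $ l" for k l
    by (simp add: matrix_vector_mult_basis column_def inner_axis')
  have q: "0 \<le> s\<^sup>2 * N $ i $ i + 2 * s * t * N $ i $ j + t\<^sup>2 * N $ j $ j" for s t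
  proof -
    have "0 \<le> (s *\<^sub>R axis i 1 + t *\<^sub>R axis j 1) \<bullet> (N *v (s *\<^sub>R axis i 1 + t *\<^sub>R axis j 1))"
      using N by (simp add: psd_def)
    then show ?thesis
      by (simp add: matrix_vector_right_distrib matrix_vector_mult_scaleR inner_add entry sym
          power2_eq_square algebra_simps)
  qed
  have "0 \<le> N $ i $ i" using q[of 1 0] by simp
  show ?thesis
  proof (cases "N $ i $ i = 0")
    case True
    have "2 * N $ i $ j = 0"
    proof (rule ccontr)
      assume "2 * N $ i $ j \<noteq> 0"
      then show False
        using q[of "- (N $ j $ j + 1) / (2 * N $ i $ j)" 1] True by (simp add: field_simps)
    qed
    then show ?thesis using True by simp
  next
    case False
    have "0 \<le> N $ i $ i * (N $ i $ i * N $ j $ j - (N $ i $ j)\<^sup>2)"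
      using q[of "- N $ i $ j" "N $ i $ i"] by (simp add: power2_eq_square algebra_simps)
    then show ?thesis
      using False \<open>0 \<le> N $ i $ i\<close> by (simp add: zero_le_mult_iff)
  qed
qed

lemma psd_norm_le_trace:
  assumes "psd N"
  shows "norm N \<le> trace N"
proof (rule power2_le_imp_le)
  have "(norm N)\<^sup>2 = (\<Sum>i\<in>UNIV. \<Sum>j\<in>UNIV. (N $ i $ j)\<^sup>2)"
    unfolding power2_norm_eq_inner inner_vec_def by (simp add: power2_eq_square)
  also have "\<dots> \<le> (\<Sum>i\<in>UNIV. \<Sum>j\<in>UNIV. N $ i $ i * N $ j $ j)"
    by (intro sum_mono psd_entry_sq_le assms)
  also have "\<dots> = (trace N)\<^sup>2"
    by (simp add: trace_def power2_eq_square sum_product)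
  finally show "(norm N)\<^sup>2 \<le> (trace N)\<^sup>2" .
  have "0 \<le> N $ i $ i" for i
    using assms by (auto simp: psd_def matrix_vector_mult_basis column_def inner_axis'
        dest!: spec[of _ "axis i 1"])
  then show "0 \<le> trace N" by (simp add: trace_def sum_nonneg)
qed

lemma psd_congruence:
  assumes "psd M" "transpose Q = Q"
  shows "psd (Q ** M ** Q)"
proof -
  have "x \<bullet> ((Q ** M ** Q) *v x) = (Q *v x) \<bullet> (M *v (Q *v x))" for x
    by (metis assms(2) dot_lmul_matrix matrix_vector_mul_assoc transpose_matrix_vector)
  then show ?thesis
    using assms by (simp add: psd_def matrix_transpose_mul matrix_mul_assoc)
qed

text \<open>
  The operator inequality \<open>l M \<le> M\<^sup>2\<close>, evaluated at the columns of \<open>Q\<close> and summed.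
\<close>

lemma trace_compression_le:
  fixes M Q :: "real^'n^'n"
  assumes gap: "\<And>x. l * (x \<bullet> (M *v x)) \<le> (M *v x) \<bullet> (M *v x)" and Q: "transpose Q = Q"
  shows "l * trace (Q ** M ** Q) \<le> (norm (M ** Q))\<^sup>2"
proof -
  let ?q = "\<lambda>j. Q *v axis j 1"
  have "(Q ** M ** Q) $ j $ j = ?q j \<bullet> (M *v ?q j)" for j
  proof -
    have "(Q ** M ** Q) $ j $ j = axis j 1 \<bullet> ((Q ** M ** Q) *v axis j 1)"
      by (simp add: matrix_vector_mult_basis column_def inner_axis')
    also have "\<dots> = ?q j \<bullet> (M *v ?q j)"
      by (metis Q dot_lmul_matrix matrix_vector_mul_assoc transpose_matrix_vector)
    finally show ?thesis .
  qed
  then have "l * trace (Q ** M ** Q) = (\<Sum>j\<in>UNIV. l * (?q j \<bullet> (M *v ?q j)))"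
    by (simp add: trace_def sum_distrib_left)
  also have "\<dots> \<le> (\<Sum>j\<in>UNIV. (M *v ?q j) \<bullet> (M *v ?q j))"
    by (intro sum_mono gap)
  also have "\<dots> = (\<Sum>j\<in>UNIV. column j (M ** Q) \<bullet> column j (M ** Q))"
    by (simp add: matrix_vector_mul_assoc flip: matrix_vector_mult_basis)
  also have "\<dots> = transpose (M ** Q) \<bullet> transpose (M ** Q)"
    by (simp add: inner_vec_def column_def transpose_def)
  also have "\<dots> = (norm (M ** Q))\<^sup>2"
    by (simp add: matrix_inner_transpose power2_norm_eq_inner)
  finally show ?thesis .
qed

text \<open>
  Since \<open>Q\<close> annihilates \<open>X\<close>, the compression of \<open>X X\<^sup>T - M\<close> by \<open>Q\<close> depends on \<open>M\<close> alone, and the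
  spectral gap bounds its norm by the square of \<open>\<parallel>M Q\<parallel> = \<parallel>D Q\<parallel>\<close>. The estimate is quadratic, so near
  the ground truth the normal component is of second order.
\<close>

lemma normal_component_bound:
  fixes M Q :: "real^'n^'n" and X :: "real^'r^'n"
  defines "D \<equiv> X ** transpose X - M"
  assumes M: "psd M" and gap: "\<And>x. l * (x \<bullet> (M *v x)) \<le> (M *v x) \<bullet> (M *v x)" and "0 \<le> l"
    and Q: "orth_projector Q" "Q ** X = 0"
  shows "2 * l * norm (Q ** D ** Q) - (norm (Q ** D ** Q))\<^sup>2 \<le> (norm D)\<^sup>2"
proof -
  have Qs: "transpose Q = Q" using Q by (simp add: orth_projector_def)
  have "transpose X ** Q = 0"
    using arg_cong[OF Q(2), of transpose] Qs
    by (simp add: matrix_transpose_mul) (simp add: transpose_def vec_eq_iff)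
  then have DQ: "D ** Q = - (M ** Q)"
    by (simp add: D_def matrix_ring_simps flip: matrix_mul_assoc)
  then have QDQ: "Q ** D ** Q = - (Q ** M ** Q)"
    by (simp add: matrix_mult_minus_right flip: matrix_mul_assoc)
  have "l * norm (Q ** D ** Q) \<le> l * trace (Q ** M ** Q)"
    using \<open>0 \<le> l\<close> psd_norm_le_trace[OF psd_congruence[OF M Qs]] by (simp add: QDQ mult_left_mono)
  also have "\<dots> \<le> (norm (D ** Q))\<^sup>2"
    using trace_compression_le[OF gap Qs] by (simp add: DQ)
  finally have "2 * l * norm (Q ** D ** Q) \<le> 2 * (norm (D ** Q))\<^sup>2" by simp
  moreover have "transpose D = D"
    using M by (simp add: D_def psd_def transpose_simps)
  ultimately show ?thesis
    using symmetric_compression_norm_le(1)[of D Q] Q by linarith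
qed

section \<open>Sensing operators\<close>

lemma sensing_eq_inner: "sensing A M = (\<chi> k. A k \<bullet> M)"
proof -
  have "trace (transpose (A k) ** M) = A k \<bullet> M" for k
    unfolding inner_vec_def trace_def matrix_matrix_mult_def transpose_def
    by simp (rule sum.swap)
  then show ?thesis by (simp add: sensing_def)
qed

lemma linear_sensing: "linear (sensing A)"
  by (rule linearI) (simp_all add: sensing_eq_inner vec_eq_iff inner_add_right)

lemma norm_vectorize: "norm (vectorize M) = norm M"
proof -
  have "vectorize M \<bullet> vectorize M = (\<Sum>p\<in>UNIV \<times> UNIV. M $ snd p $ fst p * M $ snd p $ fst p)"
    by (simp add: vectorize_def inner_vec_def flip: UNIV_Times_UNIV)
  also have "\<dots> = (\<Sum>j\<in>UNIV. \<Sum>i\<in>UNIV. M $ i $ j * M $ i $ j)"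
    by (simp add: sum.cartesian_product case_prod_beta)
  also have "\<dots> = M \<bullet> M"
    unfolding inner_vec_def by simp (rule sum.swap)
  finally show ?thesis by (simp add: norm_eq_sqrt_inner)
qed

lemma sensing_inner_noise_le:
  fixes A :: "'m::finite \<Rightarrow> real^'n^'n"
  shows "\<bar>sensing A T \<bullet> w\<bar> \<le> norm T * norm (transpose (sensing_matrix A) *v w)"
proof -
  have "sensing A T \<bullet> w = vectorize T \<bullet> (transpose (sensing_matrix A) *v w)"
    by (metis dot_lmul_matrix inner_commute sensing_matrix_mult_vectorize transpose_matrix_vector)
  then show ?thesis
    by (metis Cauchy_Schwarz_ineq2 norm_vectorize)
qed

text \<open>
  Restricted isometry controls norms only; polarization extends it to inner products of two
  matrices as long as their span stays within the rank bound.
\<close>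

lemma rip_inner_ge:
  fixes A :: "'m::finite \<Rightarrow> real^'n^'n"
  assumes rip: "rip A k \<delta>" and rank: "\<And>a b. rank (a *\<^sub>R S + b *\<^sub>R D) \<le> k"
  shows "S \<bullet> D - \<delta> * norm S * norm D \<le> sensing A S \<bullet> sensing A D"
proof (cases "S = 0 \<or> D = 0")
  case True
  then show ?thesis by (auto simp: linear_0[OF linear_sensing])
next
  case False
  define s d where "s = norm S" and "d = norm D"
  have pos: "s > 0" "d > 0" using False by (auto simp: s_def d_def)
  \<comment> \<open>Polarization on the pair rescaled to equal norms.\<close>
  define x y where "x = d *\<^sub>R S" and "y = s *\<^sub>R D"
  let ?A = "sensing A"
  have A: "?A (x + y) = ?A x + ?A y" "?A (x - y) = ?A x - ?A y"
    by (simp_all add: linear_add[OF linear_sensing] linear_diff[OF linear_sensing])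
  have "(1 - \<delta>) * (norm (x + y))\<^sup>2 \<le> (norm (?A (x + y)))\<^sup>2"
    using rip rank[of d s] by (simp add: rip_def x_def y_def)
  moreover have "(norm (?A (x - y)))\<^sup>2 \<le> (1 + \<delta>) * (norm (x - y))\<^sup>2"
    using rip rank[of d "- s"] by (simp add: rip_def x_def y_def)
  moreover have "(norm (?A (x + y)))\<^sup>2 - (norm (?A (x - y)))\<^sup>2 = 4 * (?A x \<bullet> ?A y)"
    unfolding A by (simp add: power2_norm_eq_inner inner_add inner_diff inner_commute)
  moreover have "(1 - \<delta>) * (norm (x + y))\<^sup>2 - (1 + \<delta>) * (norm (x - y))\<^sup>2
      = 4 * (x \<bullet> y) - 2 * \<delta> * (x \<bullet> x + y \<bullet> y)"
    by (simp add: power2_norm_eq_inner inner_add inner_diff inner_commute algebra_simps)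
  ultimately have "4 * (x \<bullet> y) - 2 * \<delta> * (x \<bullet> x + y \<bullet> y) \<le> 4 * (?A x \<bullet> ?A y)"
    by linarith
  also have "x \<bullet> x = (s * d)\<^sup>2"
    by (simp add: x_def s_def dot_square_norm power2_eq_square mult_ac)
  also have "y \<bullet> y = (s * d)\<^sup>2"
    by (simp add: y_def d_def dot_square_norm power2_eq_square mult_ac)
  also have "x \<bullet> y = (s * d) * (S \<bullet> D)"
    by (simp add: x_def y_def)
  also have "?A x \<bullet> ?A y = (s * d) * (?A S \<bullet> ?A D)"
    by (simp add: x_def y_def linear_scale[OF linear_sensing])
  finally have "(s * d) * (S \<bullet> D - \<delta> * s * d) \<le> (s * d) * (?A S \<bullet> ?A D)"
    by (simp add: power2_eq_square algebra_simps)
  then show ?thesis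
    using pos by (simp add: s_def d_def mult_le_cancel_left)
qed

section \<open>Local minimizers\<close>

text \<open>
  Along the line \<open>X + t U\<close> the objective is a quartic polynomial in \<open>t\<close> with this inner product as
  its linear coefficient.
\<close>

lemma first_order_condition:
  fixes A :: "'m::finite \<Rightarrow> real^'n^'n" and X U :: "real^'r^'n"
  assumes "local_minimizer (recovery_objective A b w) X"
  shows "sensing A (X ** transpose U + U ** transpose X)
    \<bullet> (sensing A (X ** transpose X) - b + w) = 0"
proof -
  let ?A = "sensing A"
  define R L K where "R = ?A (X ** transpose X) - b + w"
    and "L = ?A (X ** transpose U + U ** transpose X)" and "K = ?A (U ** transpose U)"
  define g where "g = (\<lambda>t::real. recovery_objective A b w (X + t *\<^sub>R U))"
  have g: "g t = 1 / 2 * (R \<bullet> R) + t * (L \<bullet> R) + t^2 * (R \<bullet> K + 1 / 2 * (L \<bullet> L)) + t^3 * (L \<bullet> K)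
      + t^4 * (1 / 2 * (K \<bullet> K))" for t
  proof -
    have "(X + t *\<^sub>R U) ** transpose (X + t *\<^sub>R U) = X ** transpose X
        + t *\<^sub>R (X ** transpose U + U ** transpose X) + t^2 *\<^sub>R (U ** transpose U)"
      by (simp add: transpose_simps matrix_ring_simps algebra_simps power2_eq_square)
    then have "?A ((X + t *\<^sub>R U) ** transpose (X + t *\<^sub>R U)) - b + w = R + t *\<^sub>R L + t^2 *\<^sub>R K"
      by (simp add: R_def L_def K_def linear_add[OF linear_sensing] linear_scale[OF linear_sensing])
    then have "g t = 1 / 2 * ((R + t *\<^sub>R L + t^2 *\<^sub>R K) \<bullet> (R + t *\<^sub>R L + t^2 *\<^sub>R K))"
      by (simp add: g_def recovery_objective_def power2_norm_eq_inner)
    also have "\<dots> = 1 / 2 * (R \<bullet> R) + t * (L \<bullet> R) + t^2 * (R \<bullet> K + 1 / 2 * (L \<bullet> L)) + t^3 * (L \<bullet> K)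
      + t^4 * (1 / 2 * (K \<bullet> K))"
      by (simp add: inner_add inner_commute algebra_simps eval_nat_numeral)
    finally show ?thesis .
  qed
  have "(g has_real_derivative L \<bullet> R) (at 0)"
    unfolding g[abs_def] by (auto intro!: derivative_eq_intros)
  moreover have "\<forall>\<^sub>F t in nhds 0. g 0 \<le> g t"
  proof -
    have "((\<lambda>t. X + t *\<^sub>R U) \<longlongrightarrow> X + 0 *\<^sub>R U) (nhds 0)"
      by (intro tendsto_intros filterlim_ident)
    then have "filterlim (\<lambda>t. X + t *\<^sub>R U) (nhds X) (nhds 0)" by simp
    from eventually_compose_filterlim[OF assms[unfolded local_minimizer_def] this] show ?thesis
      by (simp add: g_def)
  qed
  then obtain e where "e > 0" "\<And>t. dist t 0 < e \<Longrightarrow> g 0 \<le> g t"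
    unfolding eventually_nhds_metric by blast
  ultimately show ?thesis
    using DERIV_local_min[of g "L \<bullet> R" 0 e] by (simp add: L_def R_def)
qed

text \<open>
  With \<open>P = X K\<close>, the tangential part of \<open>D\<close> is \<open>P D + D P - P D P\<close>. Dividing the doubly counted
  block \<open>P D P\<close> evenly between \<open>X U\<^sup>T\<close> and its transpose gives \<open>U\<close>.
\<close>

lemma tangent_component:
  fixes X :: "real^'r^'n" and D :: "real^'n^'n"
  assumes P: "orth_projector (X ** K)" and D: "transpose D = D"
  defines "Q \<equiv> mat 1 - X ** K"
  obtains U :: "real^'r^'n" where "D - Q ** D ** Q = X ** transpose U + U ** transpose X"
proof -
  define P where "P = X ** K"
  have Ps: "transpose P = P" using P by (simp add: orth_projector_def P_def)
  define U where "U = transpose (K ** (D - (1 / 2) *\<^sub>R (D ** P)))"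
  have XU: "X ** transpose U = P ** D - (1 / 2) *\<^sub>R (P ** D ** P)"
    by (simp add: U_def P_def matrix_ring_simps matrix_mul_assoc)
  have "U ** transpose X = transpose (X ** transpose U)"
    by (simp add: matrix_transpose_mul)
  also have "\<dots> = D ** P - (1 / 2) *\<^sub>R (P ** D ** P)"
    unfolding XU by (simp add: transpose_simps Ps D matrix_mul_assoc)
  finally have "X ** transpose U + U ** transpose X = P ** D + D ** P - P ** D ** P"
    using XU by (simp flip: scaleR_left_distrib)
  also have "\<dots> = D - Q ** D ** Q"
    by (simp add: Q_def matrix_ring_simps flip: P_def)
  finally show thesis using that by metis
qed

text \<open>
  Modulo matrices of the form \<open>X E\<close>, both \<open>D\<close> and its tangential part reduce to \<open>Q M F\<close> for some
  \<open>F\<close>, because \<open>Q D = - Q M\<close>. Every combination is thus of the form \<open>X E + Q M F\<close>.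
\<close>

lemma projector_difference_rank:
  fixes X :: "real^'r^'n" and M :: "real^'n^'n"
  assumes "(X ** K) ** X = X"
  defines "Q \<equiv> mat 1 - X ** K" and "D \<equiv> X ** transpose X - M"
  shows "rank (a *\<^sub>R (D - Q ** D ** Q) + b *\<^sub>R D) \<le> CARD('r) + rank M"
proof -
  define P where "P = X ** K"
  have "Q ** X = 0" using assms(1) by (simp add: Q_def matrix_ring_simps)
  then have QD: "Q ** D = - (Q ** M)"
    by (simp add: D_def matrix_ring_simps matrix_mul_assoc)
  have "a *\<^sub>R (D - Q ** D ** Q) + b *\<^sub>R D =
      X ** ((a + b) *\<^sub>R (K ** D)) + Q ** (M ** (- a *\<^sub>R P - b *\<^sub>R mat 1))"
  proof -
    have D: "P ** D + Q ** D = D" by (simp add: P_def Q_def matrix_ring_simps)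
    have T: "D - Q ** D ** Q = P ** D + Q ** D ** P"
      by (simp add: P_def Q_def matrix_ring_simps)
    have "a *\<^sub>R (D - Q ** D ** Q) + b *\<^sub>R D
        = a *\<^sub>R (P ** D + Q ** D ** P) + b *\<^sub>R (P ** D + Q ** D)"
      by (simp only: T D)
    also have "\<dots> = (a + b) *\<^sub>R (P ** D) + (a *\<^sub>R (Q ** D ** P) + b *\<^sub>R (Q ** D))"
      by (simp add: algebra_simps)
    also have "(a + b) *\<^sub>R (P ** D) = X ** ((a + b) *\<^sub>R (K ** D))"
      by (simp add: P_def matrix_ring_simps matrix_mul_assoc)
    also have "a *\<^sub>R (Q ** D ** P) + b *\<^sub>R (Q ** D) = Q ** (M ** (- a *\<^sub>R P - b *\<^sub>R mat 1))"
      by (simp add: QD matrix_ring_simps matrix_mul_assoc)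
    finally show ?thesis .
  qed
  also have "rank \<dots> \<le> rank (X ** ((a + b) *\<^sub>R (K ** D))) + rank (Q ** (M ** (- a *\<^sub>R P - b *\<^sub>R mat 1)))"
    by (rule rank_add_le)
  also have "rank (X ** ((a + b) *\<^sub>R (K ** D))) \<le> CARD('r)"
    using rank_mul_le_left rank_bound[of X] by (metis le_trans min.bounded_iff)
  also have "rank (Q ** (M ** (- a *\<^sub>R P - b *\<^sub>R mat 1))) \<le> rank M"
    using rank_mul_le_right rank_mul_le_left by (rule order_trans)
  finally show ?thesis by simp
qed

lemma sqrt2_le: "sqrt 2 \<le> 3 / 2"
  by (rule real_le_lsqrt) (auto simp: power2_eq_square)

text \<open>
  The real-number part of the argument: \<open>n\<close>, \<open>t\<close> and \<open>s\<close> are the norms of \<open>D\<close>, of its tangential part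
  and of its normal part. From \<open>s \<le> n \<le> \<tau> l\<close> the bound becomes \<open>(2 - \<tau>) s \<le> \<tau> n\<close>, and
  \<open>2 - \<tau> \<ge> 2 (\<surd>2 - 1)\<close>, the reciprocal of \<open>(1 + \<surd>2) / 2\<close>.
\<close>

lemma tangent_norm_ge:
  fixes n s t l \<tau> :: real
  assumes pyth: "t\<^sup>2 = n\<^sup>2 - s\<^sup>2" and bound: "2 * l * s - s\<^sup>2 \<le> n\<^sup>2"
    and n: "0 \<le> n" "n \<le> \<tau> * l" and "0 \<le> s" "0 \<le> t" "0 < l"
    and \<tau>: "0 < \<tau>" "\<tau> < 2 * (sqrt 2 - 1)" "0 \<le> 1 - (3 + 2 * sqrt 2) / 4 * \<tau>\<^sup>2"
  shows "sqrt (1 - (3 + 2 * sqrt 2) / 4 * \<tau>\<^sup>2) * n \<le> t"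
proof -
  have "s \<le> n"
    using pyth n by (intro power2_le_imp_le[of s n]) (simp_all add: field_simps, smt (verit) zero_le_power2)
  have "l * ((2 - \<tau>) * s) \<le> 2 * l * s - s * s"
    using \<open>s \<le> n\<close> n \<open>0 \<le> s\<close> mult_right_mono[of s "\<tau> * l" s] by (simp add: algebra_simps)
  also have "\<dots> \<le> n * n" using bound by (simp add: power2_eq_square)
  also have "\<dots> \<le> l * (\<tau> * n)" using n mult_right_mono[of n "\<tau> * l" n] by (simp add: mult_ac)
  finally have "(2 - \<tau>) * s \<le> \<tau> * n" using \<open>0 < l\<close> by simp
  moreover have "2 * (sqrt 2 - 1) * s \<le> (2 - \<tau>) * s"
    using \<tau> sqrt2_le \<open>0 \<le> s\<close> by (intro mult_right_mono) auto
  ultimately have "(1 + sqrt 2) / 2 * (2 * (sqrt 2 - 1) * s) \<le> (1 + sqrt 2) / 2 * (\<tau> * n)"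
    by (intro mult_left_mono) auto
  moreover have "(1 + sqrt 2) / 2 * (2 * (sqrt 2 - 1)) = 1"
    by (simp add: field_simps)
  ultimately have "s \<le> (1 + sqrt 2) / 2 * (\<tau> * n)"
    by (metis mult.assoc mult_1)
  then have "s\<^sup>2 \<le> ((1 + sqrt 2) / 2 * (\<tau> * n))\<^sup>2"
    using \<open>0 \<le> s\<close> by (rule power_mono)
  also have "\<dots> = (3 + 2 * sqrt 2) / 4 * \<tau>\<^sup>2 * n\<^sup>2"
    by (simp add: power2_eq_square field_simps)
  finally have "(sqrt (1 - (3 + 2 * sqrt 2) / 4 * \<tau>\<^sup>2) * n)\<^sup>2 \<le> t\<^sup>2"
    using \<tau>(3) pyth by (simp add: power_mult_distrib left_diff_distrib)
  then show ?thesis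
    using \<open>0 \<le> t\<close> by (rule power2_le_imp_le)
qed

text \<open>
  The deterministic recovery bound, with \<open>l\<close> in the role of \<open>\<lambda>\<^sub>r(M)\<close>. The factor \<open>\<parallel>T\<parallel>\<close> is common to the
  restricted isometry, stationarity and noise estimates and cancels.
\<close>

lemma local_minimizer_error_bound:
  fixes M :: "real^'n^'n" and A :: "'m::finite \<Rightarrow> real^'n^'n" and X :: "real^'r^'n"
  defines "D \<equiv> X ** transpose X - M"
  assumes M: "psd M" "rank M \<le> CARD('r)"
    and gap: "\<And>x. l * (x \<bullet> (M *v x)) \<le> (M *v x) \<bullet> (M *v x)" and "0 < l"
    and rip: "rip A (2 * CARD('r)) \<delta>" and "0 \<le> \<delta>"
    and noise: "norm (transpose (sensing_matrix A) *v w) \<le> \<epsilon>"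
    and min: "local_minimizer (recovery_objective A (sensing A M) w) X"
    and near: "norm D \<le> \<tau> * l"
    and \<tau>: "0 < \<tau>" "\<tau> < 2 * (sqrt 2 - 1)" "0 \<le> 1 - (3 + 2 * sqrt 2) / 4 * \<tau>\<^sup>2"
  shows "(sqrt (1 - (3 + 2 * sqrt 2) / 4 * \<tau>\<^sup>2) - \<delta>) * norm D \<le> \<epsilon>"
proof -
  have D: "transpose D = D"
    using M by (simp add: D_def psd_def transpose_simps)
  obtain K where K: "orth_projector (X ** K)" "(X ** K) ** X = X"
    using column_space_projector by blast
  define Q where "Q = mat 1 - X ** K"
  have Q: "orth_projector Q" "Q ** X = 0"
    using K by (simp_all add: Q_def orth_projector_complement matrix_ring_simps)
  define T where "T = D - Q ** D ** Q"
  obtain U :: "real^'r^'n" where U: "T = X ** transpose U + U ** transpose X"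
    using tangent_component[OF K(1) D] unfolding T_def Q_def by blast
  have "rank (a *\<^sub>R T + b *\<^sub>R D) \<le> 2 * CARD('r)" for a b
    using projector_difference_rank[OF K(2), of a M b] M(2)
    unfolding T_def Q_def D_def by linarith
  then have "T \<bullet> D - \<delta> * norm T * norm D \<le> sensing A T \<bullet> sensing A D"
    by (rule rip_inner_ge[OF rip])
  also have "\<dots> = - (sensing A T \<bullet> w)"
    using first_order_condition[OF min, of U]
    by (simp add: D_def linear_diff[OF linear_sensing] inner_add_right flip: U)
  also have "\<dots> \<le> norm T * \<epsilon>"
    using sensing_inner_noise_le[of A T w] mult_left_mono[OF noise, of "norm T"] by simp
  finally have "norm T * norm T \<le> norm T * (\<delta> * norm D + \<epsilon>)"
    using symmetric_compression_norm_le(3)[OF D Q(1)]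
    by (simp add: T_def power2_eq_square algebra_simps)
  moreover have "0 \<le> \<delta> * norm D + \<epsilon>"
    using \<open>0 \<le> \<delta>\<close> order_trans[OF norm_ge_zero noise] by simp
  ultimately have "norm T \<le> \<delta> * norm D + \<epsilon>"
    by (cases "T = 0") auto
  moreover have "sqrt (1 - (3 + 2 * sqrt 2) / 4 * \<tau>\<^sup>2) * norm D \<le> norm T"
    using symmetric_compression_norm_le(2)[OF D Q(1)] near \<open>0 < l\<close> \<tau>
      normal_component_bound[OF M(1) gap _ Q]
    by (intro tangent_norm_ge[of "norm T" "norm D" "norm (Q ** D ** Q)" l])
      (simp_all add: T_def D_def)
  ultimately show ?thesis by (simp add: left_diff_distrib)
qed

lemma error_const_ge_1:
  assumes "0 < nth_eigval r M" "nth_eigval r M \<le> nth_eigval 1 M" "0 < \<tau>" "\<tau> < 1"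
  shows "1 \<le> error_const \<tau> r M"
proof -
  have "0 < (1 - \<tau>) * nth_eigval r M" using assms by simp
  moreover have "(1 - \<tau>) * nth_eigval r M \<le> nth_eigval r M"
    using assms by (simp add: mult_left_le_one_le)
  moreover have "0 < \<tau> * nth_eigval r M" using assms by simp
  then have "nth_eigval r M \<le> 2 * (nth_eigval 1 M + \<tau> * nth_eigval r M)"
    using assms by (smt (verit))
  ultimately show ?thesis
    unfolding error_const_def by (simp add: le_divide_eq)
qed

lemma continuous_recovery_objective:
  fixes A :: "'m::finite \<Rightarrow> real^'n^'n"
  shows "continuous_on UNIV (\<lambda>z :: (real^'m) \<times> (real^'r^'n). recovery_objective A b (fst z) (snd z))"
  unfolding recovery_objective_def sensing_eq_inner matrix_matrix_mult_def transpose_def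
  by (intro continuous_intros)

section \<open>Recovery with high probability\<close>

theorem theorem4:
  fixes Mstar :: "real^'n^'n"
    and A :: "'m::finite \<Rightarrow> real^'n^'n"
    and P :: "'a measure"
    and w :: "'a \<Rightarrow> real^'m"
    and \<delta> \<epsilon> \<tau> :: real
  assumes "psd Mstar"
    and "rank Mstar = CARD('r::finite)"
    and "prob_space P"
    and "w \<in> borel_measurable P"
    and "0 \<le> \<delta>" and "\<delta> < 1"
    and "rip A (2 * CARD('r)) \<delta>"
    and "\<epsilon> > 0"
    and "0 < \<tau>" and "\<tau> < 2 * (sqrt 2 - 1)"
    and "\<delta> < sqrt (1 - (3 + 2 * sqrt 2) / 4 * \<tau>\<^sup>2)"
  shows "measure P {\<omega> \<in> space P. \<forall>X :: real^'r^'n.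
            local_minimizer (recovery_objective A (sensing A Mstar) (w \<omega>)) X \<longrightarrow>
            norm (X ** transpose X - Mstar) \<le> \<tau> * nth_eigval CARD('r) Mstar \<longrightarrow>
            norm (X ** transpose X - Mstar)
              \<le> \<epsilon> * (1 + \<delta>) * error_const \<tau> CARD('r) Mstar /
                 (sqrt (1 - (3 + 2 * sqrt 2) / 4 * \<tau>\<^sup>2) - \<delta>)}
         \<ge> measure P {\<omega> \<in> space P. norm (transpose (sensing_matrix A) *v w \<omega>) \<le> \<epsilon>}"
    (is "measure P ?good \<ge> measure P ?small")
proof -
  interpret prob_space P by (rule assms)
  let ?l = "nth_eigval CARD('r) Mstar"
  let ?q = "sqrt (1 - (3 + 2 * sqrt 2) / 4 * \<tau>\<^sup>2)"
  let ?C = "error_const \<tau> CARD('r) Mstar"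
  have rank: "rank Mstar \<le> CARD('r)" "1 \<le> CARD('r)" "CARD('r) \<le> CARD('n)"
    using rank_bound[of Mstar] assms(2) by simp_all
  have q: "0 < ?q" using assms by linarith
  have \<tau>1: "\<tau> < 1"
    using assms(10) sqrt2_le by simp
  have bound: "norm (X ** transpose X - Mstar) \<le> \<epsilon> * (1 + \<delta>) * ?C / (?q - \<delta>)"
    if small: "norm (transpose (sensing_matrix A) *v v) \<le> \<epsilon>"
      and min: "local_minimizer (recovery_objective A (sensing A Mstar) v) X"
      and near: "norm (X ** transpose X - Mstar) \<le> \<tau> * ?l" for v and X :: "real^'r^'n"
  proof -
    have "0 \<le> \<tau> * ?l" using near norm_ge_zero order_trans by blast
    \<comment> \<open>For \<open>?l = 0\<close> the constant is a quotient by zero, but then the proximity assumption forces the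
      error to vanish.\<close>
    then consider "?l = 0" | "0 < ?l" using \<open>0 < \<tau>\<close> by (force simp: zero_le_mult_iff)
    then show ?thesis
    proof cases
      case 1
      then show ?thesis using near by (simp add: error_const_def)
    next
      case 2
      have "(?q - \<delta>) * norm (X ** transpose X - Mstar) \<le> \<epsilon>"
        using q nth_eigval_rank_quadratic[OF assms(1) rank]
        by (intro local_minimizer_error_bound[OF assms(1) rank(1) _ 2 assms(7,5) small min near assms(9,10)])
          auto
      also have "\<epsilon> \<le> \<epsilon> * ((1 + \<delta>) * ?C)"
      proof -
        have "1 \<le> ?C"
          using 2 \<tau>1 assms nth_eigval_le_largest[OF assms(1) rank] by (intro error_const_ge_1) auto
        then have "1 * 1 \<le> (1 + \<delta>) * ?C"
          using assms by (intro mult_mono) auto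
        then show ?thesis using \<open>\<epsilon> > 0\<close> by simp
      qed
      finally show ?thesis
        using assms by (simp add: le_divide_eq mult_ac)
    qed
  qed
  have "?good \<in> sets P"
  proof -
    let ?B = "{v. \<forall>X :: real^'r^'n. local_minimizer (recovery_objective A (sensing A Mstar) v) X \<longrightarrow>
            norm (X ** transpose X - Mstar) \<le> \<tau> * ?l \<longrightarrow>
            norm (X ** transpose X - Mstar) \<le> \<epsilon> * (1 + \<delta>) * ?C / (?q - \<delta>)}"
    have "?B \<in> sets borel"
      unfolding matrix_matrix_mult_def transpose_def
      by (intro borel_local_minimizer_parameters continuous_recovery_objective continuous_intros)
    then have "w -` ?B \<inter> space P \<in> sets P"
      using assms(4) by (rule measurable_sets[rotated])
    then show ?thesis by (simp add: vimage_def Int_def conj_commute)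
  qed
  moreover have "?small \<subseteq> ?good" using bound by blast
  ultimately show ?thesis by (intro finite_measure_mono)
qed

end
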